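(* For each $n$ let $M_n$ be a matching of size $n$. Then: \begin{enumerate} \item $\mathrm{SP}_{\mathbb{Z}}(M_n) = O\big(\mathrm{SP}_{\mathbb{Z}}(K_n)/\sqrt{n}\big)$; \item there is a constant $\epsilon>0$ such that $\mathrm{SP}_{\mathbb{Z}}(M_n) \le n/(\log n)^{\epsilon}$ for all sufficiently large $n$. \end{enumerate} In particular, if $\mathrm{SP}_{\mathbb{Z}}(M_n) = \Omega(n^{1/2+\delta})$ for some $\delta>0$, then every $n$-element subset $A\subset\mathbb{Z}$ satisfies $\max\{|A+A|,|A\times A|\} \ge \Omega(n^{1+\delta})$.
   Context: A matching of size $n$ is a graph consisting of $n$ pairwise disjoint edges (on $2n$ vertices). $K_n$ is the complete graph on $n$ vertices. For a finite simple graph $G=(V,E)$, a ring $R$ and an injective map $A=(a_u)_{u\in V}$ from $V$ to $R$, put $A+_G A=\{a_u+a_v : uv\in E\}$ and $A\times_G A=\{a_u a_v : uv\in E\}$. The sum-product of $G$ over $R$, $\mathrm{SP}_R(G)$, is the minimum of $\max\{|A+_G A|,|A\times_G A|\}$ over all injections $A:V\to R$. For a set $A\subset \mathbb{Z}$, $A+A=\{x+y: x,y\in A\}$ and $A\times A=\{xy: x,y\in A\}$. The $O$ and $\Omega$ notation is for $n\to\infty$; the constant in the final $\Omega$ does not depend on the set $A$. *)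

theory Defs
  imports
    Complex_Main
    "HOL-Library.Landau_Symbols"
    "HOL-Library.Disjoint_Sets"
    "HOL-Library.Set_Algebras"
begin

type_synonym 'a graph = "'a set \<times> 'a set set"

abbreviation verts :: "'a graph \<Rightarrow> 'a set" where "verts \<equiv> fst"
abbreviation edges :: "'a graph \<Rightarrow> 'a set set" where "edges \<equiv> snd"

definition finite_simple_graph :: "'a graph \<Rightarrow> bool" where
  "finite_simple_graph G \<longleftrightarrow>
     finite (verts G) \<and> (\<forall>e \<in> edges G. e \<subseteq> verts G \<and> card e = 2)"

definition matching :: "nat \<Rightarrow> 'a graph \<Rightarrow> bool" where
  "matching n G \<longleftrightarrow>
     finite_simple_graph G \<and> verts G = \<Union>(edges G) \<and> disjoint (edges G) \<and> card (edges G) = n"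

definition complete_graph :: "nat \<Rightarrow> nat graph" where
  "complete_graph n = ({..<n}, {e. e \<subseteq> {..<n} \<and> card e = 2})"

definition graph_sums :: "'a graph \<Rightarrow> ('a \<Rightarrow> 'r::ring) \<Rightarrow> 'r set" where
  "graph_sums G a = {a u + a v | u v. {u, v} \<in> edges G}"

definition graph_products :: "'a graph \<Rightarrow> ('a \<Rightarrow> 'r::ring) \<Rightarrow> 'r set" where
  "graph_products G a = {a u * a v | u v. {u, v} \<in> edges G}"

text \<open>The ring is given by its type. The infimum in \<^typ>\<open>nat\<close> is a minimum whenever an injection
  of the vertices into the ring exists, so always for a finite graph and the ring \<^typ>\<open>int\<close>.\<close>

definition sum_product :: "'r::ring itself \<Rightarrow> 'a graph \<Rightarrow> nat" where
  "sum_product R G =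
     Inf {max (card (graph_sums G a)) (card (graph_products G a)) | a :: 'a \<Rightarrow> 'r.
       inj_on a (verts G)}"

end

theory Submission
  imports Defs "HOL-Analysis.Harmonic_Numbers" "HOL-Computational_Algebra.Primes"
begin

text \<open>
  An unordered pair of distinct integers is regarded as an edge, and its sum and product together
  determine it. Let \<open>A\<close> be a set of \<open>N\<close> nonzero integers, \<open>S\<close> and \<open>T\<close> the sets of sums and products
  of its edges. Keep each element of \<open>S\<close> with probability \<open>p\<close> and each element of \<open>T\<close> with
  probability \<open>q\<close>, where \<open>p * q\<close> is a small multiple of \<open>1 / N\<close>, and keep an edge if both its sum and
  its product are kept. The expected number of kept edges is about \<open>p * q * N\<^sup>2 / 2\<close>, of order \<open>N\<close>.
  Two distinct edges with a common vertex have different sums and, \<open>0\<close> being excluded, different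
  products, so they are both kept with probability \<open>(p * q)\<^sup>2\<close> only; the expected number of such pairs
  is at most a smaller multiple of \<open>N\<close>. Deleting one edge from each such pair leaves a matching with
  at least \<open>N / 128\<close> edges, \<open>O(p * card S)\<close> sums and \<open>O(q * card T)\<close> products
  (\<open>sparse_matching_in_set\<close>). A bounded number of disjoint dilates of this matching has at least \<open>n\<close>
  edges if \<open>n = O(N)\<close>, and the numbers of sums and products grow by that bounded factor only
  (\<open>matching_sum_product_le_of_set\<close>).

  With \<open>p = q\<close> of order \<open>1 / sqrt n\<close> and \<open>A\<close> an optimal \<open>n\<close>-element set without its possible element
  \<open>0\<close>, this bounds the sum-product of a matching by that of the complete graph, divided by
  \<open>sqrt n\<close>. The same bound for an arbitrary \<open>n\<close>-element set gives the last claim.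

  The logarithmic saving comes from a set \<open>A\<close> of at least \<open>n / 2\<close> of the integers up to \<open>n\<close> that has
  only \<open>O(n\<^sup>2 / (ln n) powr (1/20))\<close> products (\<open>dense_set_with_few_products\<close>), combined with
  \<open>p = (ln n) powr (-1/40)\<close> and \<open>q\<close> of order \<open>(ln n) powr (1/40) / n\<close>. The set is an instance of
  Erdos's argument for the multiplication table. Let \<open>L\<close> be the sum of the reciprocals of the primes
  in \<open>(22, n]\<close>, and let \<open>A\<close> consist of the integers up to \<open>n\<close> with at least \<open>0.9 * L\<close> prime divisors
  in this range. Turan's second moment argument (\<open>turan\<close>) shows that \<open>A\<close> is dense. A product of two
  elements of \<open>A\<close> is an integer up to \<open>n\<^sup>2\<close> with at least \<open>1.8 * L\<close> such prime factors, counted with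
  multiplicity, whereas the mean of \<open>2\<close> to the number of these factors is at most \<open>exp (1.1 * L)\<close>
  (\<open>sum_two_power_prime_weight_le\<close>). As \<open>1.8 * ln 2 > 1.2\<close>, at most \<open>n\<^sup>2 * exp (- 0.1 * L)\<close> integers
  are products. Finally \<open>L \<ge> ln (ln n) / 2 - 22\<close>, by comparing the harmonic series with an Euler
  product (\<open>sum_prime_reciprocals_ge\<close>).
\<close>

section \<open>Random subsets of sums and products\<close>

text \<open>The probability that the random subset of the finite set \<open>S\<close> that contains each element
  independently with probability \<open>p\<close> is equal to \<open>B\<close>, for \<open>B \<subseteq> S\<close>.\<close>

definition bernoulli_weight :: "real \<Rightarrow> 'a set \<Rightarrow> 'a set \<Rightarrow> real" where
  "bernoulli_weight p S B = p ^ card B * (1 - p) ^ card (S - B)"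

lemma bernoulli_weight_nonneg: "0 \<le> p \<Longrightarrow> p \<le> 1 \<Longrightarrow> 0 \<le> bernoulli_weight p S B"
  by (simp add: bernoulli_weight_def)

text \<open>A fixed set \<open>U\<close> is contained in the random subset with probability \<open>p ^ card U\<close>. Expectations
  of all other quantities reduce to this one by linearity.\<close>

lemma bernoulli_weight_superset:
  assumes "finite S" "U \<subseteq> S"
  shows "(\<Sum>B\<in>Pow S. bernoulli_weight p S B * of_bool (U \<subseteq> B)) = p ^ card U"
proof -
  let ?f = "\<lambda>x. if x \<in> U then 0 else 1 - p"
  have "bernoulli_weight p S B * of_bool (U \<subseteq> B) = (\<Prod>x\<in>B. p) * (\<Prod>x\<in>S-B. ?f x)"
    if "B \<in> Pow S" for B
  proof (cases "U \<subseteq> B")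
    case True
    then have "(\<Prod>x\<in>S-B. ?f x) = (\<Prod>x\<in>S-B. 1 - p)" by (intro prod.cong) auto
    then show ?thesis using True by (simp add: bernoulli_weight_def)
  next
    case False
    then have "(\<Prod>x\<in>S-B. ?f x) = 0" using assms by (intro prod_zero) auto
    then show ?thesis using False by simp
  qed
  then have "(\<Sum>B\<in>Pow S. bernoulli_weight p S B * of_bool (U \<subseteq> B)) = (\<Prod>x\<in>S. p + ?f x)"
    by (simp add: prod_add[OF assms(1)])
  also have "\<dots> = (\<Prod>x\<in>S. if x \<in> U then p else 1)" by (intro prod.cong) auto
  also have "\<dots> = p ^ card U"
    using assms by (simp add: prod.If_cases Int_absorb1)
  finally show ?thesis .
qed

lemma exists_ge_weighted_mean:
  fixes W Z :: "'a \<Rightarrow> real"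
  assumes "finite I" "\<And>i. i \<in> I \<Longrightarrow> W i \<ge> 0" "sum W I = 1"
  shows "\<exists>i\<in>I. (\<Sum>j\<in>I. W j * Z j) \<le> Z i"
proof (rule ccontr)
  let ?m = "\<Sum>j\<in>I. W j * Z j"
  assume "\<not> (\<exists>i\<in>I. ?m \<le> Z i)"
  then have lt: "Z i < ?m" if "i \<in> I" for i using that by force
  have "(\<Sum>i\<in>I. W i * (?m - Z i)) = ?m * sum W I - ?m"
    by (simp add: right_diff_distrib sum_subtractf sum_distrib_right[symmetric] mult.commute)
  then have "(\<Sum>i\<in>I. W i * (?m - Z i)) = 0" using assms(3) by simp
  moreover have "W i * (?m - Z i) \<ge> 0" if "i \<in> I" for i
    using assms(2)[OF that] lt[OF that] by simp
  ultimately have "\<forall>i\<in>I. W i * (?m - Z i) = 0"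
    using sum_nonneg_eq_0_iff[OF assms(1), of "\<lambda>i. W i * (?m - Z i)"] by simp
  then have "\<forall>i\<in>I. W i = 0" using lt by fastforce
  then show False using assms(3) by simp
qed

text \<open>The elements \<open>e\<close> of \<open>E\<close> have two labels \<open>\<sigma> e\<close> and \<open>\<tau> e\<close>, and \<open>C\<close> is a set of conflicting pairs,
  which differ in both labels. If \<open>B\<close> and \<open>D\<close> are independent random subsets of the labels with
  densities \<open>p\<close> and \<open>q\<close>, the left-hand side of the inequality below is the expectation of the
  right-hand side, so that some choice of \<open>B\<close> and \<open>D\<close> does at least as well.\<close>

lemma random_sampling:
  fixes \<sigma> :: "'e \<Rightarrow> 's" and \<tau> :: "'e \<Rightarrow> 't" and p q \<alpha> \<beta> :: real
  assumes E: "finite E" and C: "C \<subseteq> E \<times> E"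
    and Cs: "\<And>e e'. (e, e') \<in> C \<Longrightarrow> \<sigma> e \<noteq> \<sigma> e' \<and> \<tau> e \<noteq> \<tau> e'"
    and p: "0 \<le> p" "p \<le> 1" and q: "0 \<le> q" "q \<le> 1"
  obtains B D where "B \<subseteq> \<sigma> ` E" "D \<subseteq> \<tau> ` E"
    "p * q * card E - (p * q)^2 * card C - \<alpha> * p * card (\<sigma> ` E) - \<beta> * q * card (\<tau> ` E)
      \<le> real (card {e \<in> E. \<sigma> e \<in> B \<and> \<tau> e \<in> D})
        - card {(e, e') \<in> C. \<sigma> e \<in> B \<and> \<tau> e \<in> D \<and> \<sigma> e' \<in> B \<and> \<tau> e' \<in> D}
        - \<alpha> * card B - \<beta> * card D"
proof -
  let ?S = "\<sigma> ` E" and ?T = "\<tau> ` E"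
  let ?I = "Pow ?S \<times> Pow ?T"
  let ?W = "\<lambda>(B, D). bernoulli_weight p ?S B * bernoulli_weight q ?T D"
  let ?b = "\<lambda>U V (B, D). of_bool (U \<subseteq> B) * of_bool (V \<subseteq> D) :: real"
  have fC: "finite C" using C E by (meson finite_SigmaI finite_subset)
  have fS: "finite ?S" and fT: "finite ?T" using E by auto
  \<comment> \<open>The probability that \<open>U\<close> and \<open>V\<close> are contained in the two random subsets.\<close>
  have mean: "(\<Sum>x\<in>?I. ?W x * ?b U V x) = p ^ card U * q ^ card V"
    if "U \<subseteq> ?S" "V \<subseteq> ?T" for U V
  proof -
    have "(\<Sum>x\<in>?I. ?W x * ?b U V x) =
      (\<Sum>B\<in>Pow ?S. bernoulli_weight p ?S B * of_bool (U \<subseteq> B)) *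
      (\<Sum>D\<in>Pow ?T. bernoulli_weight q ?T D * of_bool (V \<subseteq> D))"
      unfolding sum_product sum.cartesian_product by (intro sum.cong) (auto simp: mult_ac)
    then show ?thesis
      using bernoulli_weight_superset[OF fS that(1)] bernoulli_weight_superset[OF fT that(2)]
      by simp
  qed
  \<comment> \<open>The right-hand side as a function of \<open>B\<close> and \<open>D\<close>, written as a combination of indicators.\<close>
  define Z where "Z = (\<lambda>x. (\<Sum>e\<in>E. ?b {\<sigma> e} {\<tau> e} x)
     - (\<Sum>c\<in>C. ?b {\<sigma> (fst c), \<sigma> (snd c)} {\<tau> (fst c), \<tau> (snd c)} x)
     - \<alpha> * (\<Sum>s\<in>?S. ?b {s} {} x) - \<beta> * (\<Sum>t\<in>?T. ?b {} {t} x))"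
  have "(\<Sum>x\<in>?I. ?W x * Z x) =
      (\<Sum>e\<in>E. \<Sum>x\<in>?I. ?W x * ?b {\<sigma> e} {\<tau> e} x)
     - (\<Sum>c\<in>C. \<Sum>x\<in>?I. ?W x * ?b {\<sigma> (fst c), \<sigma> (snd c)} {\<tau> (fst c), \<tau> (snd c)} x)
     - \<alpha> * (\<Sum>s\<in>?S. \<Sum>x\<in>?I. ?W x * ?b {s} {} x) - \<beta> * (\<Sum>t\<in>?T. \<Sum>x\<in>?I. ?W x * ?b {} {t} x)"
    unfolding Z_def
    by (simp add: right_diff_distrib sum_subtractf sum_distrib_left
        sum.swap[of _ E ?I] sum.swap[of _ C ?I] sum.swap[of _ ?S ?I] sum.swap[of _ ?T ?I]
        mult.left_commute[of _ \<alpha>] mult.left_commute[of _ \<beta>])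
  also have "(\<Sum>e\<in>E. \<Sum>x\<in>?I. ?W x * ?b {\<sigma> e} {\<tau> e} x) = (\<Sum>e\<in>E. p * q)"
    by (intro sum.cong refl, subst mean) auto
  also have "(\<Sum>c\<in>C. \<Sum>x\<in>?I. ?W x * ?b {\<sigma> (fst c), \<sigma> (snd c)} {\<tau> (fst c), \<tau> (snd c)} x)
    = (\<Sum>c\<in>C. (p * q)^2)"
  proof (intro sum.cong refl, subst mean)
    fix c assume c: "c \<in> C"
    show "{\<sigma> (fst c), \<sigma> (snd c)} \<subseteq> ?S" "{\<tau> (fst c), \<tau> (snd c)} \<subseteq> ?T" using c C by auto
    have "card {\<sigma> (fst c), \<sigma> (snd c)} = 2" "card {\<tau> (fst c), \<tau> (snd c)} = 2"
      using Cs[of "fst c" "snd c"] c by auto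
    then show "p ^ card {\<sigma> (fst c), \<sigma> (snd c)} * q ^ card {\<tau> (fst c), \<tau> (snd c)} = (p * q)^2"
      by (simp add: power_mult_distrib)
  qed
  also have "(\<Sum>s\<in>?S. \<Sum>x\<in>?I. ?W x * ?b {s} {} x) = (\<Sum>s\<in>?S. p)"
    by (intro sum.cong refl, subst mean) auto
  also have "(\<Sum>t\<in>?T. \<Sum>x\<in>?I. ?W x * ?b {} {t} x) = (\<Sum>t\<in>?T. q)"
    by (intro sum.cong refl, subst mean) auto
  finally have EZ: "(\<Sum>x\<in>?I. ?W x * Z x) =
     p * q * card E - (p * q)^2 * card C - \<alpha> * p * card ?S - \<beta> * q * card ?T"
    by (simp add: mult_ac)
  have "\<exists>x\<in>?I. (\<Sum>x\<in>?I. ?W x * Z x) \<le> Z x"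
  proof (rule exists_ge_weighted_mean)
    show "finite ?I" using fS fT by simp
    show "?W x \<ge> 0" if "x \<in> ?I" for x
      using p q by (auto simp: bernoulli_weight_nonneg split: prod.split)
    show "sum ?W ?I = 1" using mean[of "{}" "{}"] by (simp add: case_prod_beta)
  qed
  then obtain B D where BD: "B \<subseteq> ?S" "D \<subseteq> ?T" and le: "(\<Sum>x\<in>?I. ?W x * Z x) \<le> Z (B, D)"
    by auto
  have "Z (B, D) = real (card {e \<in> E. \<sigma> e \<in> B \<and> \<tau> e \<in> D})
        - card {(e, e') \<in> C. \<sigma> e \<in> B \<and> \<tau> e \<in> D \<and> \<sigma> e' \<in> B \<and> \<tau> e' \<in> D}
        - \<alpha> * card B - \<beta> * card D"
  proof -
    have "(\<Sum>e\<in>E. ?b {\<sigma> e} {\<tau> e} (B, D)) = card {e \<in> E. \<sigma> e \<in> B \<and> \<tau> e \<in> D}"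
    proof -
      have "(\<Sum>e\<in>E. ?b {\<sigma> e} {\<tau> e} (B, D)) = (\<Sum>e\<in>E. if \<sigma> e \<in> B \<and> \<tau> e \<in> D then 1 else 0)"
        by (intro sum.cong) auto
      then show ?thesis using E by (simp add: sum.If_cases Int_def)
    qed
    moreover have "(\<Sum>c\<in>C. ?b {\<sigma> (fst c), \<sigma> (snd c)} {\<tau> (fst c), \<tau> (snd c)} (B, D)) =
      card {(e, e') \<in> C. \<sigma> e \<in> B \<and> \<tau> e \<in> D \<and> \<sigma> e' \<in> B \<and> \<tau> e' \<in> D}"
    proof -
      have "(\<Sum>c\<in>C. ?b {\<sigma> (fst c), \<sigma> (snd c)} {\<tau> (fst c), \<tau> (snd c)} (B, D)) =
        (\<Sum>c\<in>C. if \<sigma> (fst c) \<in> B \<and> \<tau> (fst c) \<in> D \<and> \<sigma> (snd c) \<in> B \<and> \<tau> (snd c) \<in> D then 1 else 0)"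
        by (intro sum.cong) auto
      also have "\<dots> = card {c \<in> C. \<sigma> (fst c) \<in> B \<and> \<tau> (fst c) \<in> D \<and> \<sigma> (snd c) \<in> B \<and> \<tau> (snd c) \<in> D}"
        using fC by (simp add: sum.If_cases Int_def)
      also have "{c \<in> C. \<sigma> (fst c) \<in> B \<and> \<tau> (fst c) \<in> D \<and> \<sigma> (snd c) \<in> B \<and> \<tau> (snd c) \<in> D} =
        {(e, e') \<in> C. \<sigma> e \<in> B \<and> \<tau> e \<in> D \<and> \<sigma> e' \<in> B \<and> \<tau> e' \<in> D}" by auto
      finally show ?thesis .
    qed
    moreover have "(\<Sum>s\<in>?S. ?b {s} {} (B, D)) = card B"
      using BD(1) fS by (simp add: of_bool_def sum.If_cases Int_absorb1)
    moreover have "(\<Sum>t\<in>?T. ?b {} {t} (B, D)) = card D"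
      using BD(2) fT by (simp add: of_bool_def sum.If_cases Int_absorb1)
    ultimately show ?thesis by (simp only: Z_def)
  qed
  with le EZ BD show ?thesis using that by auto
qed

section \<open>Matchings of integers\<close>

lemma sum_product_le:
  fixes a :: "'a \<Rightarrow> int"
  assumes "inj_on a (verts G)"
  shows "sum_product TYPE(int) G \<le> max (card (graph_sums G a)) (card (graph_products G a))"
  unfolding sum_product_def by (intro wellorder_Inf_le1) (use assms in auto)

lemma sum_product_attained:
  assumes "finite_simple_graph G"
  obtains a :: "'a \<Rightarrow> int" where "inj_on a (verts G)"
    "sum_product TYPE(int) G = max (card (graph_sums G a)) (card (graph_products G a))"
proof -
  let ?X = "{max (card (graph_sums G a)) (card (graph_products G a)) | a :: 'a \<Rightarrow> int.
       inj_on a (verts G)}"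
  obtain f :: "'a \<Rightarrow> nat" where "inj_on f (verts G)"
    using assms finite_imp_inj_to_nat_seg[of "verts G"] by (auto simp: finite_simple_graph_def)
  then have "inj_on (int \<circ> f) (verts G)" by (simp add: comp_inj_on)
  then have "?X \<noteq> {}" by blast
  then have "Inf ?X \<in> ?X" by (rule Inf_nat_def1)
  then show ?thesis using that by (auto simp: sum_product_def)
qed

text \<open>A matching of size at least \<open>n\<close> whose vertices are integers gives an injective labelling of
  every matching of size \<open>n\<close>: its edges are sent injectively to edges, and the two ends of each edge to the
  two ends of its image.\<close>

lemma matching_sum_product_le:
  fixes G :: "'a graph" and F :: "int set set"
  assumes G: "matching n G"
    and F: "finite F" "disjoint F" "\<And>e. e \<in> F \<Longrightarrow> card e = 2" "n \<le> card F"
  shows "sum_product TYPE(int) G \<le> max (card (sum id ` F)) (card (prod id ` F))"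
proof -
  have Gsimple: "finite (verts G)" "\<And>e. e \<in> edges G \<Longrightarrow> card e = 2"
    and Gverts: "verts G = \<Union>(edges G)" and Gdisj: "disjoint (edges G)" and Gcard: "card (edges G) = n"
    using G by (auto simp: matching_def finite_simple_graph_def)
  have "finite (edges G)" using Gsimple(1) Gverts by (simp add: finite_UnionD)
  then obtain g where g: "g ` edges G \<subseteq> F" "inj_on g (edges G)"
    using card_le_inj[of "edges G" F] F Gcard by auto
  have "\<exists>h. bij_betw h e (g e)" if "e \<in> edges G" for e
  proof (rule finite_same_card_bij)
    have "card e = 2" "card (g e) = 2" using Gsimple(2) F(3) g(1) that by auto
    then show "finite e" "finite (g e)" "card e = card (g e)" by (auto intro: card_ge_0_finite)
  qed
  then obtain h where h: "\<And>e. e \<in> edges G \<Longrightarrow> bij_betw (h e) e (g e)" by metis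
  define ed where "ed v = (THE e. e \<in> edges G \<and> v \<in> e)" for v
  have ed: "ed v = e" if "e \<in> edges G" "v \<in> e" for e v
    unfolding ed_def using that Gdisj by (intro the_equality) (auto simp: disjoint_def)
  define a where "a v = h (ed v) v" for v
  have a: "a v = h e v" "a v \<in> g e" if "e \<in> edges G" "v \<in> e" for e v
    using ed[OF that] h[OF that(1)] that(2) by (auto simp: a_def bij_betw_def)
  have "inj_on a (verts G)"
  proof (rule inj_onI)
    fix u v assume "u \<in> verts G" "v \<in> verts G" and eq: "a u = a v"
    then obtain e e' where e: "e \<in> edges G" "u \<in> e" and e': "e' \<in> edges G" "v \<in> e'"
      using Gverts by auto
    have "g e \<inter> g e' \<noteq> {}" using a(2)[OF e] a(2)[OF e'] eq by auto
    then have "g e = g e'" using F(2) g(1) e(1) e'(1) unfolding disjoint_def by blast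
    then have "e = e'" using g(2) e(1) e'(1) by (auto dest: inj_onD)
    then show "u = v" using a(1)[OF e] a(1)[OF e'] eq h[OF e(1)] e(2) e'(2)
      by (auto simp: bij_betw_def dest: inj_onD)
  qed
  moreover have edge: "a u + a v \<in> sum id ` F \<and> a u * a v \<in> prod id ` F" if "{u, v} \<in> edges G" for u v
  proof -
    have "u \<noteq> v" using Gsimple(2)[OF that] by auto
    moreover have "g {u, v} = {a u, a v}" "inj_on (h {u, v}) {u, v}"
      using h[OF that] a(1)[OF that] by (auto simp: bij_betw_def)
    ultimately have "a u \<noteq> a v" "{a u, a v} \<in> F" using a(1)[OF that] g(1) that by (auto simp: inj_on_def)
    then show ?thesis by (intro conjI image_eqI[of _ _ "{a u, a v}"]) auto
  qed
  ultimately have "sum_product TYPE(int) G \<le> max (card (graph_sums G a)) (card (graph_products G a))"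
    by (intro sum_product_le)
  also have "\<dots> \<le> max (card (sum id ` F)) (card (prod id ` F))"
    using edge F(1) by (intro max.mono card_mono) (auto simp: graph_sums_def graph_products_def)
  finally show ?thesis .
qed

text \<open>The family \<open>F'\<close> is a disjoint union of \<open>K\<close> dilates of \<open>F\<close>. Dilating does not change the number
  of sums or of products.\<close>

lemma repeat_matching:
  fixes F :: "int set set"
  assumes F: "finite F" "disjoint F" "\<And>e. e \<in> F \<Longrightarrow> card e = 2" "0 \<notin> \<Union>F"
  obtains F' :: "int set set" where "finite F'" "disjoint F'" "\<And>e. e \<in> F' \<Longrightarrow> card e = 2" "0 \<notin> \<Union>F'"
    "card F' = K * card F" "card (sum id ` F') \<le> K * card (sum id ` F)"
    "card (prod id ` F') \<le> K * card (prod id ` F)"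
proof -
  have "\<exists>F' :: int set set. finite F' \<and> disjoint F' \<and> (\<forall>e\<in>F'. card e = 2) \<and> 0 \<notin> \<Union>F' \<and>
    card F' = K * card F \<and> card (sum id ` F') \<le> K * card (sum id ` F) \<and>
    card (prod id ` F') \<le> K * card (prod id ` F)"
  proof (induction K)
    case 0
    then show ?case by (intro exI[of _ "{}"]) auto
  next
    case (Suc K)
    then obtain F' :: "int set set" where F': "finite F'" "disjoint F'" "\<And>e. e \<in> F' \<Longrightarrow> card e = 2" "0 \<notin> \<Union>F'"
      "card F' = K * card F" "card (sum id ` F') \<le> K * card (sum id ` F)"
      "card (prod id ` F') \<le> K * card (prod id ` F)" by blast
    have fine: "finite e" if "e \<in> F' \<or> e \<in> F" for e
      using F(3) F'(3) that by (auto intro: card_ge_0_finite)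
    \<comment> \<open>As \<open>0\<close> is not a vertex, dilating by a number larger than all vertices of \<open>F'\<close> moves every
      vertex of \<open>F\<close> out of reach of \<open>F'\<close>.\<close>
    define c where "c = 1 + (\<Sum>v\<in>\<Union>F'. \<bar>v\<bar>)"
    have fV: "finite (\<Union>F')" using F'(1) fine by auto
    have c: "c > \<bar>v\<bar>" if "v \<in> \<Union>F'" for v
      using member_le_sum[OF that _ fV, of abs] by (auto simp: c_def)
    have c0: "c > 0" unfolding c_def by (simp add: add_pos_nonneg sum_nonneg)
    have inj: "inj ((*) c)" using c0 by (auto intro: injI)
    let ?H = "image ((*) c) ` F"
    have far: "c * v \<notin> \<Union>F'" if "v \<in> \<Union>F" for v
    proof
      assume "c * v \<in> \<Union>F'"
      then have "\<bar>c * v\<bar> < c" by (rule c)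
      moreover have "\<bar>v\<bar> \<ge> 1" using F(4) that by (cases "v = 0") auto
      then have "c * 1 \<le> c * \<bar>v\<bar>" using c0 by (intro mult_left_mono) auto
      ultimately show False using c0 by (simp add: abs_mult)
    qed
    have disj: "F' \<inter> ?H = {}"
    proof (rule equals0I)
      fix e assume e: "e \<in> F' \<inter> ?H"
      then have "e \<noteq> {}" using F'(3) by force
      then show False using e far by blast
    qed
    have sums: "sum id ` ?H = (*) c ` sum id ` F"
      using inj by (auto simp: image_image sum.reindex inj_on_def sum_distrib_left intro!: image_cong)
    have prods: "prod id ` ?H = (*) (c^2) ` prod id ` F"
    proof -
      have "prod id ((*) c ` e) = c^2 * prod id e" if "e \<in> F" for e
        using F(3)[OF that] inj by (simp add: prod.reindex inj_on_def prod.distrib)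
      then show ?thesis by (auto simp: image_image)
    qed
    have "finite (F' \<union> ?H)" using F F' by auto
    moreover have "disjoint (F' \<union> ?H)"
    proof (rule disjointI)
      fix e e' assume ee: "e \<in> F' \<union> ?H" "e' \<in> F' \<union> ?H" "e \<noteq> e'"
      have *: "(*) c ` d \<inter> (*) c ` d' = {}" if "d \<in> F" "d' \<in> F" "(*) c ` d \<noteq> (*) c ` d'" for d d'
        using F(2) that inj unfolding disjoint_def by (metis image_Int image_empty)
      have **: "d \<inter> (*) c ` d' = {}" if "d \<in> F'" "d' \<in> F" for d d'
        using far that by blast
      have ***: "d \<inter> d' = {}" if "d \<in> F'" "d' \<in> F'" "d \<noteq> d'" for d d'
        using F'(2) that by (simp add: disjoint_def)
      from ee(1,2) consider "e \<in> F'" "e' \<in> F'" | "e \<in> F'" "e' \<in> ?H" | "e \<in> ?H" "e' \<in> F'"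
        | "e \<in> ?H" "e' \<in> ?H" by blast
      then show "e \<inter> e' = {}"
      proof cases
        case 1
        then show ?thesis using ***[of e e'] ee(3) by simp
      next
        case 2
        then obtain d' where "d' \<in> F" "e' = (*) c ` d'" by blast
        then show ?thesis using **[of e d'] 2 by simp
      next
        case 3
        then obtain d where "d \<in> F" "e = (*) c ` d" by blast
        then show ?thesis using **[of e' d] 3 by (simp add: Int_commute)
      next
        case 4
        then obtain d d' where "d \<in> F" "e = (*) c ` d" "d' \<in> F" "e' = (*) c ` d'" by blast
        then show ?thesis using *[of d d'] ee(3) by simp
      qed
    qed
    moreover have "\<forall>e\<in>F' \<union> ?H. card e = 2"
      using F F' inj by (auto simp: card_image inj_on_def)
    moreover have "0 \<notin> \<Union>(F' \<union> ?H)" using F(4) F'(4) c0 by auto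
    moreover have "card (F' \<union> ?H) = Suc K * card F"
    proof -
      have "card ?H = card F"
        using inj by (intro card_image inj_onI) (simp add: inj_image_eq_iff)
      then show ?thesis using card_Un_disjoint[OF F'(1) _ disj] F F' by simp
    qed
    moreover have "card (sum id ` (F' \<union> ?H)) \<le> Suc K * card (sum id ` F)"
    proof -
      have "card (sum id ` (F' \<union> ?H)) \<le> card (sum id ` F') + card (sum id ` ?H)"
        unfolding image_Un by (rule card_Un_le)
      moreover have "card (sum id ` ?H) \<le> card (sum id ` F)"
        unfolding sums using F(1) by (intro card_image_le) auto
      ultimately show ?thesis using F'(6) by simp
    qed
    moreover have "card (prod id ` (F' \<union> ?H)) \<le> Suc K * card (prod id ` F)"
    proof -
      have "card (prod id ` (F' \<union> ?H)) \<le> card (prod id ` F') + card (prod id ` ?H)"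
        unfolding image_Un by (rule card_Un_le)
      moreover have "card (prod id ` ?H) \<le> card (prod id ` F)"
        unfolding prods using F(1) by (intro card_image_le) auto
      ultimately show ?thesis using F'(7) by simp
    qed
    ultimately show ?case by blast
  qed
  then show ?thesis using that by blast
qed

section \<open>Sparse matchings with few sums and products\<close>

text \<open>The deletion argument: sample sums and products, keep the edges whose sum and product are both
  sampled, and delete one edge from each pair of kept edges with a common vertex.\<close>

lemma sparse_matching_in_set:
  fixes A :: "int set" and p q :: real
  assumes A: "finite A" "0 \<notin> A" "card A \<ge> 2"
    and p: "0 < p" "p \<le> 1" and q: "0 < q" "q \<le> 1" and pq: "p * q = 1 / (8 * card A)"
  defines "E \<equiv> {e. e \<subseteq> A \<and> card e = 2}"
  obtains F where "F \<subseteq> E" "disjoint F" "real (card A) \<le> 128 * card F"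
    "card (sum id ` F) \<le> 128 * p * card (sum id ` E)"
    "card (prod id ` F) \<le> 128 * q * card (prod id ` E)"
proof -
  let ?N = "real (card A)"
  let ?S = "sum id ` E" and ?T = "prod id ` E"
  define C where "C = {(e, e') \<in> E \<times> E. e \<noteq> e' \<and> e \<inter> e' \<noteq> {}}"
  have finE: "finite E" unfolding E_def using A(1) by (auto intro: finite_subset[of _ "Pow A"])
  have N2: "?N \<ge> 2" using A(3) by simp
  have cardE: "2 * real (card E) = ?N * (?N - 1)"
  proof -
    have "card E = card A choose 2" unfolding E_def by (rule n_subsets[OF A(1)])
    moreover have "even (card A * (card A - 1))" by auto
    ultimately have "2 * card E = card A * (card A - 1)"
      by (simp only: choose_two dvd_mult_div_cancel)
    then have "real (2 * card E) = real (card A * (card A - 1))" by simp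
    then show ?thesis using A(3) by (simp add: of_nat_diff)
  qed
  have shared: "\<exists>a b c. a \<in> A \<and> b \<in> A \<and> c \<in> A \<and> a \<noteq> b \<and> a \<noteq> c \<and> b \<noteq> c \<and> e = {a, b} \<and> e' = {a, c}"
    if "(e, e') \<in> C" for e e'
  proof -
    from that have e: "e \<subseteq> A" "card e = 2" and e': "e' \<subseteq> A" "card e' = 2"
      and ne: "e \<noteq> e'" "e \<inter> e' \<noteq> {}" by (auto simp: C_def E_def)
    from ne(2) obtain a where a: "a \<in> e" "a \<in> e'" by blast
    obtain b where b: "e = {a, b}" "a \<noteq> b" using e(2) a(1) by (auto simp: card_2_iff)
    obtain c where c: "e' = {a, c}" "a \<noteq> c" using e'(2) a(2) by (auto simp: card_2_iff)
    show ?thesis using b c e(1) e'(1) ne(1) by blast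
  qed
  have cardC: "real (card C) \<le> ?N ^ 3"
  proof -
    have "C \<subseteq> (\<lambda>(a, b, c). ({a, b}, {a, c})) ` (A \<times> A \<times> A)"
    proof
      fix x assume "x \<in> C"
      then obtain a b c where "a \<in> A" "b \<in> A" "c \<in> A" "x = ({a, b}, {a, c})"
        using shared[of "fst x" "snd x"] by (metis prod.collapse)
      then show "x \<in> (\<lambda>(a, b, c). ({a, b}, {a, c})) ` (A \<times> A \<times> A)" by force
    qed
    then have "card C \<le> card (A \<times> A \<times> A)"
      using A(1) by (intro surj_card_le) auto
    also have "\<dots> = card A ^ 3" by (simp add: power3_eq_cube card_cartesian_product)
    finally show ?thesis by (metis of_nat_le_iff of_nat_power)
  qed
  have sep: "sum id e \<noteq> sum id e' \<and> prod id e \<noteq> prod id e'" if "(e, e') \<in> C" for e e'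
  proof -
    obtain a b c where "a \<in> A" "a \<noteq> b" "a \<noteq> c" "b \<noteq> c" "e = {a, b}" "e' = {a, c}"
      using shared[OF \<open>(e, e') \<in> C\<close>] by blast
    then show ?thesis using A(2) by auto
  qed
  have "E \<noteq> {}"
  proof
    assume "E = {}"
    then show False using cardE N2 by simp
  qed
  then have S0: "real (card ?S) > 0" and T0: "real (card ?T) > 0"
    using finE by (simp_all add: card_gt_0_iff)
  \<comment> \<open>With these weights, each of the two penalties for the sampled sums and products has expectation
    \<open>N / 256\<close>.\<close>
  define \<alpha> where "\<alpha> = ?N / (256 * p * card ?S)"
  define \<beta> where "\<beta> = ?N / (256 * q * card ?T)"
  have "C \<subseteq> E \<times> E" by (auto simp: C_def)
  then obtain B D where BD: "B \<subseteq> ?S" "D \<subseteq> ?T" and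
    sampled: "p * q * card E - (p * q)^2 * card C - \<alpha> * p * card ?S - \<beta> * q * card ?T
      \<le> real (card {e \<in> E. sum id e \<in> B \<and> prod id e \<in> D})
        - card {(e, e') \<in> C. sum id e \<in> B \<and> prod id e \<in> D \<and> sum id e' \<in> B \<and> prod id e' \<in> D}
        - \<alpha> * card B - \<beta> * card D"
    by (rule random_sampling[OF finE _ _ less_imp_le[OF p(1)] p(2) less_imp_le[OF q(1)] q(2),
          where \<alpha> = \<alpha> and \<beta> = \<beta>]) (erule sep)
  define X where "X = {e \<in> E. sum id e \<in> B \<and> prod id e \<in> D}"
  define Y where "Y = {(e, e') \<in> C. sum id e \<in> B \<and> prod id e \<in> D \<and> sum id e' \<in> B \<and> prod id e' \<in> D}"
  define F where "F = X - fst ` Y"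
  have FE: "F \<subseteq> E" by (auto simp: F_def X_def)
  have finF: "finite F" using FE finE finite_subset by blast
  have "disjoint F"
  proof (rule disjointI, rule ccontr)
    fix e e' assume ee: "e \<in> F" "e' \<in> F" "e \<noteq> e'" "e \<inter> e' \<noteq> {}"
    then have "(e, e') \<in> Y" by (auto simp: F_def X_def Y_def C_def)
    then have "e \<in> fst ` Y" by force
    then show False using ee(1) by (simp add: F_def)
  qed
  have YC: "Y \<subseteq> C" "finite C"
    using finE by (auto simp: Y_def C_def intro: finite_subset[of _ "E \<times> E"])
  then have finY: "finite Y" using finite_subset by blast
  have "card X - card Y \<le> card F"
  proof -
    have "card X - card (fst ` Y) \<le> card F"
      unfolding F_def using finY by (intro diff_card_le_card_Diff) auto
    moreover have "card (fst ` Y) \<le> card Y" by (rule card_image_le[OF finY])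
    ultimately show ?thesis by linarith
  qed
  then have XYF: "real (card X) - card Y \<le> card F" by linarith
  have low: "?N / 128 \<le> p * q * card E - (p * q)^2 * card C - \<alpha> * p * card ?S - \<beta> * q * card ?T"
  proof -
    have "p * q * card E = (?N - 1) / 16" using cardE N2 by (simp add: pq field_simps)
    moreover have "(p * q)^2 * card C \<le> (p * q)^2 * ?N ^ 3" using cardC by (intro mult_left_mono) auto
    moreover have "(p * q)^2 * ?N ^ 3 = ?N / 64"
      using N2 by (simp add: pq power_divide power_mult_distrib power2_eq_square power3_eq_cube)
    moreover have "\<alpha> * p * card ?S = ?N / 256" using p S0 by (simp add: \<alpha>_def)
    moreover have "\<beta> * q * card ?T = ?N / 256" using q T0 by (simp add: \<beta>_def)
    ultimately show ?thesis using N2 by argo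
  qed
  have \<alpha>: "\<alpha> > 0" and \<beta>: "\<beta> > 0" using p q S0 T0 N2 by (simp_all add: \<alpha>_def \<beta>_def)
  have main: "?N / 128 + \<alpha> * card B + \<beta> * card D \<le> card F"
    using low sampled XYF unfolding X_def Y_def by linarith
  \<comment> \<open>A matching inside \<open>A\<close> has at most \<open>N / 2\<close> edges. This upper bound for \<open>card F\<close> turns the
    inequality above into bounds for the numbers of sampled sums and products.\<close>
  moreover have "2 * real (card F) \<le> ?N"
  proof -
    have "finite e" if "e \<in> F" for e
      using that FE A(1) by (auto simp: E_def intro: finite_subset)
    then have "card (\<Union>F) = sum card F"
      using \<open>disjoint F\<close> by (intro card_Union_disjoint)
        (auto simp: disjoint_def pairwise_def disjnt_def)
    also have "\<dots> = (\<Sum>e\<in>F. 2)" using FE by (intro sum.cong) (auto simp: E_def)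
    finally have "2 * card F = card (\<Union>F)" by simp
    also have "\<dots> \<le> card A" using FE A(1) by (intro card_mono) (auto simp: E_def)
    finally show ?thesis by linarith
  qed
  moreover have "\<alpha> * card B \<ge> 0" "\<beta> * card D \<ge> 0" using \<alpha> \<beta> by auto
  ultimately have le: "\<alpha> * card B \<le> ?N / 2" "\<beta> * card D \<le> ?N / 2" "?N \<le> 128 * card F" using N2 by linarith+
  have "real (card B) \<le> 128 * p * card ?S"
    using le(1) p S0 N2 by (simp add: \<alpha>_def field_simps)
  moreover have "real (card D) \<le> 128 * q * card ?T"
    using le(2) q T0 N2 by (simp add: \<beta>_def field_simps)
  moreover have "card (sum id ` F) \<le> card B" "card (prod id ` F) \<le> card D"
    using BD finE by (auto intro!: card_mono simp: F_def X_def intro: finite_subset)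
  ultimately show ?thesis using that[of F] FE \<open>disjoint F\<close> le(3) by linarith
qed

text \<open>The matching inside \<open>A\<close> has at least \<open>N / 128\<close> edges and \<open>n \<le> 4 * N\<close>, so \<open>512\<close> dilates of it
  have at least \<open>n\<close> edges; \<open>65536 = 512 * 128\<close>.\<close>

lemma matching_sum_product_le_of_set:
  fixes G :: "'a graph" and A :: "int set" and p q :: real
  assumes G: "matching n G" and A: "finite A" "0 \<notin> A" "card A \<ge> 2" "n \<le> 4 * card A"
    and p: "0 < p" "p \<le> 1" and q: "0 < q" "q \<le> 1" and pq: "p * q = 1 / (8 * card A)"
  shows "sum_product TYPE(int) G \<le>
    65536 * max (p * card (sum id ` {e. e \<subseteq> A \<and> card e = 2})) (q * card (prod id ` {e. e \<subseteq> A \<and> card e = 2}))"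
    (is "_ \<le> _ * max (p * card ?S) (q * card ?T)")
proof -
  let ?E = "{e. e \<subseteq> A \<and> card e = 2}"
  obtain F where F: "F \<subseteq> ?E" "disjoint F" "real (card A) \<le> 128 * card F"
    "card (sum id ` F) \<le> 128 * p * card ?S" "card (prod id ` F) \<le> 128 * q * card ?T"
    using sparse_matching_in_set[OF A(1,2,3) p q pq] by blast
  have "finite ?E" using A(1) by (auto intro: finite_subset[of _ "Pow A"])
  then have "finite F" using F(1) finite_subset by blast
  moreover have "\<And>e. e \<in> F \<Longrightarrow> card e = 2" "0 \<notin> \<Union>F" using F(1) A(2) by auto
  ultimately obtain F' :: "int set set" where F': "finite F'" "disjoint F'" "\<And>e. e \<in> F' \<Longrightarrow> card e = 2"
    "card F' = 512 * card F" "card (sum id ` F') \<le> 512 * card (sum id ` F)"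
    "card (prod id ` F') \<le> 512 * card (prod id ` F)"
    using repeat_matching[of F 512] F(2) by metis
  have "n \<le> card F'" using F(3) A(4) F'(4) by linarith
  then have "sum_product TYPE(int) G \<le> max (card (sum id ` F')) (card (prod id ` F'))"
    using matching_sum_product_le[OF G] F' by blast
  then have "real (sum_product TYPE(int) G) \<le> max (real (card (sum id ` F'))) (real (card (prod id ` F')))"
    by linarith
  also have "\<dots> \<le> max (65536 * (p * card ?S)) (65536 * (q * card ?T))"
    using F(4,5) F'(5,6) by (intro max.mono) linarith+
  also have "\<dots> = 65536 * max (p * card ?S) (q * card ?T)" by (simp add: max_mult_distrib_left)
  finally show ?thesis .
qed

section \<open>Dense sets of integers with few products\<close>

text \<open>The number of prime factors in \<open>P\<close> of a positive integer \<open>m\<close>, counted with multiplicity, for a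
  finite set \<open>P\<close> of primes.\<close>

definition prime_weight :: "nat set \<Rightarrow> nat \<Rightarrow> nat" where
  "prime_weight P m = (\<Sum>p\<in>P. multiplicity p m)"

lemma prime_weight_mult:
  assumes "\<And>p. p \<in> P \<Longrightarrow> prime p" "a > 0" "b > 0"
  shows "prime_weight P (a * b) = prime_weight P a + prime_weight P b"
  unfolding prime_weight_def sum.distrib[symmetric]
  using assms by (intro sum.cong refl prime_elem_multiplicity_mult_distrib) auto

lemma card_prime_divisors_le_prime_weight:
  assumes "\<And>p. p \<in> P \<Longrightarrow> prime p" "finite P" "m > 0"
  shows "card {p \<in> P. p dvd m} \<le> prime_weight P m"
proof -
  have "card {p \<in> P. p dvd m} = (\<Sum>p\<in>{p \<in> P. p dvd m}. 1)" by simp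
  also have "\<dots> \<le> (\<Sum>p\<in>{p \<in> P. p dvd m}. multiplicity p m)"
  proof (intro sum_mono)
    fix p assume p: "p \<in> {p \<in> P. p dvd m}"
    then have "prime p" using assms(1) by simp
    then show "1 \<le> multiplicity p m"
      using assms(3) p by (intro multiplicity_geI) (auto dest: prime_gt_1_nat)
  qed
  also have "\<dots> \<le> prime_weight P m"
    unfolding prime_weight_def using assms(2) by (intro sum_mono2) auto
  finally show ?thesis .
qed

lemma sum_multiples:
  fixes f :: "nat \<Rightarrow> real"
  assumes "p > 0"
  shows "(\<Sum>m\<in>{1..X}. if p dvd m then f m else 0) = (\<Sum>m\<in>{1..X div p}. f (p * m))"
proof -
  have "(\<Sum>m\<in>{1..X}. if p dvd m then f m else 0) = (\<Sum>m\<in>{m\<in>{1..X}. p dvd m}. f m)"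
    by (rule sum.inter_filter[symmetric]) simp
  also have "{m\<in>{1..X}. p dvd m} = (*) p ` {1..X div p}"
  proof (intro equalityI subsetI)
    fix m assume "m \<in> {m\<in>{1..X}. p dvd m}"
    then obtain k where "m = p * k" "1 \<le> p * k" "p * k \<le> X" by (auto elim!: dvdE)
    then show "m \<in> (*) p ` {1..X div p}" using assms
      by (auto simp: less_eq_div_iff_mult_less_eq mult.commute Suc_le_eq)
  next
    fix m assume "m \<in> (*) p ` {1..X div p}"
    then show "m \<in> {m\<in>{1..X}. p dvd m}" using assms
      by (auto simp: less_eq_div_iff_mult_less_eq mult.commute Suc_le_eq)
  qed
  also have "(\<Sum>m\<in>(*) p ` {1..X div p}. f m) = (\<Sum>m\<in>{1..X div p}. f (p * m))"
    using assms by (subst sum.reindex) (auto simp: inj_on_def)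
  finally show ?thesis .
qed

lemma prime_weight_mult_coprime:
  assumes "\<And>r. r \<in> P \<Longrightarrow> prime r" "prime p" "p \<notin> P" "m > 0"
  shows "prime_weight P (p * m) = prime_weight P m"
proof -
  have "multiplicity r p = 0" if "r \<in> P" for r
    using assms(1)[OF that] assms(2,3) that
    by (metis not_dvd_imp_multiplicity_0 primes_dvd_imp_eq)
  then show ?thesis
    using prime_weight_mult[of P p m] assms prime_gt_0_nat[OF assms(2)]
    by (simp add: prime_weight_def)
qed

text \<open>The completely multiplicative function \<open>2 ^ prime_weight P m\<close> has mean at most the product over
  \<open>p \<in> P\<close> of \<open>1 + (1 / p + 2 / p\<^sup>2 + 4 / p ^ 3 + \<dots>)\<close>. The primes are added one at a time.\<close>

lemma sum_two_power_prime_weight_le: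
  assumes "finite P" "\<And>p. p \<in> P \<Longrightarrow> prime p \<and> p > 2"
  shows "(\<Sum>m\<in>{1..X}. 2 ^ prime_weight P m :: real) \<le> X * (\<Prod>p\<in>P. 1 + 1 / (real p - 2))"
  using assms
proof (induction P arbitrary: X rule: finite_induct)
  case empty
  then show ?case by (simp add: prime_weight_def)
next
  case (insert p P)
  let ?K = "\<Prod>p\<in>P. 1 + 1 / (real p - 2)"
  let ?f = "\<lambda>m. 2 ^ prime_weight P m :: real" and ?g = "\<lambda>m. 2 ^ prime_weight (insert p P) m :: real"
  have pp: "prime p" and p2: "real p > 2" using insert.prems by auto
  have P: "\<And>r. r \<in> P \<Longrightarrow> prime r" using insert.prems by auto
  have K: "?K \<ge> 0" using insert.prems by (intro prod_nonneg) force
  have IH: "(\<Sum>m\<in>{1..Y}. ?f m) \<le> Y * ?K" for Y using insert by auto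
  have gm: "?g (p * m) = 2 * ?g m" "?f (p * m) = ?f m" if "m > 0" for m
  proof -
    have "prime_weight (insert p P) p = 1"
    proof -
      have "multiplicity r p = 0" if "r \<in> P" for r
        using P[OF that] pp insert.hyps that
        by (metis not_dvd_imp_multiplicity_0 primes_dvd_imp_eq)
      moreover have "multiplicity p p = 1"
        using pp by (intro multiplicity_self) (auto dest: prime_gt_1_nat)
      ultimately show ?thesis using insert.hyps by (simp add: prime_weight_def)
    qed
    then show "?g (p * m) = 2 * ?g m"
      using prime_weight_mult[of "insert p P" p m] that insert.prems pp prime_gt_0_nat[OF pp]
      by simp
    show "?f (p * m) = ?f m"
      using prime_weight_mult_coprime[of P p m] that P pp insert.hyps by simp
  qed
  have gf: "?g m = ?f m" if "\<not> p dvd m" for m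
    using insert.hyps that by (simp add: prime_weight_def not_dvd_imp_multiplicity_0)
  \<comment> \<open>The increase caused by the new prime \<open>p\<close> comes from the multiples of \<open>p\<close> only. Writing them as
    \<open>p * m\<close> gives a recursion in \<open>Y div p\<close>, whose solution is a geometric series in \<open>2 / p\<close>.\<close>
  define D where "D Y = (\<Sum>m\<in>{1..Y}. ?g m - ?f m)" for Y
  have D_rec: "D Y = 2 * D (Y div p) + (\<Sum>m\<in>{1..Y div p}. ?f m)" for Y
  proof -
    have "D Y = (\<Sum>m\<in>{1..Y}. if p dvd m then ?g m - ?f m else 0)"
      unfolding D_def by (intro sum.cong) (auto simp: gf)
    also have "\<dots> = (\<Sum>m\<in>{1..Y div p}. ?g (p * m) - ?f (p * m))"
      using p2 by (intro sum_multiples) auto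
    also have "\<dots> = (\<Sum>m\<in>{1..Y div p}. 2 * (?g m - ?f m) + ?f m)"
      by (intro sum.cong refl) (use gm in auto)
    finally show ?thesis by (simp only: D_def sum.distrib sum_distrib_left)
  qed
  have D_le: "D Y \<le> Y * ?K * (1 / (real p - 2))" for Y
  proof (induction Y rule: less_induct)
    case (less Y)
    show ?case
    proof (cases "Y = 0")
      case True
      then show ?thesis by (simp add: D_def)
    next
      case False
      let ?Z = "real (Y div p)"
      have "Y div p < Y" using False p2 by simp
      then have "D Y \<le> 2 * (?Z * ?K * (1 / (real p - 2))) + ?Z * ?K"
        using D_rec[of Y] less IH[of "Y div p"] by fastforce
      also have "\<dots> = ?Z * (?K * (p / (real p - 2)))" using p2 by (simp add: field_simps)
      also have "\<dots> \<le> (Y / p) * (?K * (p / (real p - 2)))"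
        using K p2 by (intro mult_right_mono of_nat_div_le_of_nat mult_nonneg_nonneg) auto
      also have "\<dots> = Y * ?K * (1 / (real p - 2))" using p2 by (simp add: field_simps)
      finally show ?thesis .
    qed
  qed
  have "(\<Sum>m\<in>{1..X}. ?g m) = (\<Sum>m\<in>{1..X}. ?f m) + D X" by (simp add: D_def sum_subtractf)
  also have "\<dots> \<le> X * ?K + X * ?K * (1 / (real p - 2))" by (intro add_mono IH D_le)
  also have "\<dots> = X * (\<Prod>p\<in>insert p P. 1 + 1 / (real p - 2))"
    using insert.hyps by (simp add: algebra_simps)
  finally show ?case .
qed

text \<open>A partial sum of the Euler product: every integer counted for \<open>insert p P\<close> is counted for \<open>P\<close>
  or is \<open>p\<close> times a smaller integer counted for \<open>insert p P\<close>.\<close>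

lemma harm_smooth_le:
  assumes "finite P" "\<And>p. p \<in> P \<Longrightarrow> prime p"
  shows "(\<Sum>n\<in>{n\<in>{1..X}. prime_factors n \<subseteq> P}. 1 / real n) \<le> (\<Prod>p\<in>P. 1 / (1 - 1 / real p))"
  using assms
proof (induction P rule: finite_induct)
  case empty
  have "{n\<in>{1..X}. prime_factors n \<subseteq> {}} \<subseteq> {1}" by (auto simp: prime_factorization_empty_iff)
  then have "(\<Sum>n\<in>{n\<in>{1..X}. prime_factors n \<subseteq> {}}. 1 / real n) \<le> (\<Sum>n\<in>{1::nat}. 1 / real n)"
    by (intro sum_mono2) auto
  then show ?case by simp
next
  case (insert p P)
  let ?s = "\<lambda>P n. if prime_factors n \<subseteq> P then 1 / real n else 0"
  have eq: "(\<Sum>n\<in>{n\<in>{1..X}. prime_factors n \<subseteq> P}. 1 / real n) = (\<Sum>n\<in>{1..X}. ?s P n)" for P X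
    by (rule sum.inter_filter) simp
  have pp: "prime p" using insert by auto
  then have p1: "real p > 1" using prime_gt_1_nat[OF pp] by simp
  have "(\<Sum>n\<in>{1..X}. ?s (insert p P) n) \<le>
      (\<Sum>n\<in>{1..X}. ?s P n + (if p dvd n then ?s (insert p P) n else 0))"
  proof (intro sum_mono)
    fix n assume n: "n \<in> {1..X}"
    have "prime_factors n \<subseteq> P" if "prime_factors n \<subseteq> insert p P" "\<not> p dvd n"
      using that by (auto simp: in_prime_factors_iff)
    then show "?s (insert p P) n \<le> ?s P n + (if p dvd n then ?s (insert p P) n else 0)" by auto
  qed
  also have "\<dots> = (\<Sum>n\<in>{1..X}. ?s P n) + (\<Sum>n\<in>{1..X div p}. ?s (insert p P) (p * n))"
    using p1 by (simp only: sum.distrib, subst sum_multiples) auto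
  also have "(\<Sum>n\<in>{1..X div p}. ?s (insert p P) (p * n)) =
     (\<Sum>n\<in>{1..X div p}. 1 / p * ?s (insert p P) n)"
  proof (intro sum.cong refl)
    fix n assume "n \<in> {1..X div p}"
    then have "prime_factors (p * n) = insert p (prime_factors n)"
      using pp by (subst prime_factors_product) (auto simp: prime_prime_factors dest: prime_gt_0_nat)
    then show "?s (insert p P) (p * n) = 1 / p * ?s (insert p P) n" by auto
  qed
  also have "\<dots> = 1 / p * (\<Sum>n\<in>{1..X div p}. ?s (insert p P) n)"
    by (simp add: sum_distrib_left)
  also have "\<dots> \<le> 1 / p * (\<Sum>n\<in>{1..X}. ?s (insert p P) n)"
    by (intro mult_left_mono sum_mono2) (auto intro: order.trans[OF _ div_le_dividend])
  finally have "(1 - 1 / p) * (\<Sum>n\<in>{1..X}. ?s (insert p P) n) \<le> (\<Sum>n\<in>{1..X}. ?s P n)"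
    by (simp add: algebra_simps)
  also have "\<dots> \<le> (\<Prod>p\<in>P. 1 / (1 - 1 / real p))"
    using insert by (simp only: eq) auto
  finally have "(\<Sum>n\<in>{1..X}. ?s (insert p P) n) \<le> (\<Prod>p\<in>P. 1 / (1 - 1 / real p)) / (1 - 1 / p)"
    using p1 by (subst pos_le_divide_eq) (auto simp: mult.commute)
  then show ?case unfolding eq using insert.hyps by (simp add: mult.commute)
qed

lemma sum_prime_reciprocals_ge:
  assumes "N \<ge> 2"
  shows "(\<Sum>p\<in>{p. prime p \<and> p \<le> N}. 1 / real p) \<ge> ln (ln (real N)) / 2"
proof -
  let ?P = "{p. prime p \<and> p \<le> N}"
  have fin: "finite ?P" by simp
  have "ln (real N) \<le> ln (real N + 1)" using assms by simp
  also have "\<dots> \<le> harm N" by (rule ln_le_harm)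
  also have "harm N = (\<Sum>n\<in>{n\<in>{1..N}. prime_factors n \<subseteq> ?P}. 1 / real n)"
  proof -
    have "{n\<in>{1..N}. prime_factors n \<subseteq> ?P} = {1..N}"
      by (auto simp: in_prime_factors_iff dest!: dvd_imp_le)
    then show ?thesis by (simp add: harm_def inverse_eq_divide)
  qed
  also have "\<dots> \<le> (\<Prod>p\<in>?P. 1 / (1 - 1 / real p))" by (intro harm_smooth_le) auto
  also have "\<dots> \<le> (\<Prod>p\<in>?P. exp (2 * (1 / real p)))"
  proof (intro prod_mono conjI)
    fix p assume "p \<in> ?P"
    then have p: "real p \<ge> 2" using prime_ge_2_nat by force
    show "0 \<le> 1 / (1 - 1 / real p)" using p by simp
    have "1 / (1 - 1 / real p) \<le> 1 + 2 * (1 / real p)" using p by (simp add: field_simps)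
    also have "\<dots> \<le> exp (2 * (1 / real p))" by (rule exp_ge_add_one_self)
    finally show "1 / (1 - 1 / real p) \<le> exp (2 * (1 / real p))" .
  qed
  also have "\<dots> = exp (2 * (\<Sum>p\<in>?P. 1 / real p))"
    by (simp add: exp_sum[OF fin] sum_distrib_left)
  finally have *: "ln (real N) \<le> exp (2 * (\<Sum>p\<in>?P. 1 / real p))" .
  have "ln (real N) > 0" using assms by simp
  then have "ln (ln (real N)) \<le> ln (exp (2 * (\<Sum>p\<in>?P. 1 / real p)))"
    using * by (subst ln_le_cancel_iff) auto
  then show ?thesis by simp
qed

text \<open>Turan's inequality: the number of prime divisors in \<open>P\<close> of an integer up to \<open>N\<close> deviates from
  its approximate mean \<open>L\<close> by \<open>O(sqrt L)\<close> in quadratic mean.\<close>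

lemma turan:
  fixes P :: "nat set" and N :: nat and L :: real
  assumes P: "finite P" "\<And>p. p \<in> P \<Longrightarrow> prime p \<and> p \<le> N"
  defines "L \<equiv> \<Sum>p\<in>P. 1 / real p"
  shows "(\<Sum>a\<in>{1..N}. (real (card {p \<in> P. p dvd a}) - L)\<^sup>2) \<le> 3 * N * L"
proof -
  let ?w = "\<lambda>a. real (card {p \<in> P. p dvd a})"
  let ?d = "\<lambda>p a. of_bool (p dvd a) :: real"
  have w: "?w a = (\<Sum>p\<in>P. ?d p a)" for a
    using P(1) by (simp add: of_bool_def sum.If_cases Int_def)
  have cnt: "(\<Sum>a\<in>{1..N}. ?d n a) = real (N div n)" if "n > 0" for n :: nat
    using sum_multiples[OF that, of "\<lambda>_. 1" N] by (simp add: of_bool_def)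
  have p0: "real p > 1" "p > 0" if "p \<in> P" for p using P(2)[OF that] prime_gt_1_nat[of p] by auto
  have L0: "L \<ge> 0" unfolding L_def by (intro sum_nonneg) auto
  have first: "(\<Sum>a\<in>{1..N}. ?w a) \<ge> N * L - N"
  proof -
    have "card P \<le> card {1..N}"
      using P by (intro card_mono) (auto dest!: P(2) prime_gt_0_nat)
    then have cP: "real (card P) \<le> N" by simp
    have "N * L - N \<le> N * L - card P" using cP by simp
    also have "\<dots> = (\<Sum>p\<in>P. real N / real p - 1)"
      by (simp add: L_def sum_subtractf sum_distrib_left)
    also have "\<dots> \<le> (\<Sum>p\<in>P. real (N div p))"
    proof (intro sum_mono)
      fix p assume "p \<in> P"
      then have p: "p > 0" using p0 by auto
      have "real N \<le> real (p + N div p * p)"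
        using dividend_less_div_times[OF p, of N] by (simp only: of_nat_le_iff)
      then show "real N / real p - 1 \<le> real (N div p)"
        using p by (simp add: field_simps)
    qed
    also have "\<dots> = (\<Sum>p\<in>P. \<Sum>a\<in>{1..N}. ?d p a)"
      using p0 by (intro sum.cong refl cnt[symmetric]) auto
    also have "\<dots> = (\<Sum>a\<in>{1..N}. ?w a)" unfolding w by (rule sum.swap)
    finally show ?thesis .
  qed
  have second: "(\<Sum>a\<in>{1..N}. (?w a)\<^sup>2) \<le> N * L + N * L\<^sup>2"
  proof -
    have "(\<Sum>a\<in>{1..N}. (?w a)\<^sup>2) = (\<Sum>p\<in>P. \<Sum>r\<in>P. \<Sum>a\<in>{1..N}. ?d p a * ?d r a)"
      unfolding w power2_eq_square sum_product
      by (subst sum.swap, subst (2) sum.swap) simp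
    also have "\<dots> \<le> (\<Sum>p\<in>P. \<Sum>r\<in>P. N * (1 / p) * (1 / r) + (if p = r then N * (1 / p) else 0))"
    proof (intro sum_mono)
      fix p r assume pr: "p \<in> P" "r \<in> P"
      show "(\<Sum>a\<in>{1..N}. ?d p a * ?d r a) \<le> N * (1 / p) * (1 / r) + (if p = r then N * (1 / p) else 0)"
      proof (cases "p = r")
        case True
        have "(\<Sum>a\<in>{1..N}. ?d p a * ?d r a) = real (N div p)"
          using cnt[of p] p0 pr True by (simp flip: of_bool_conj)
        also have "\<dots> \<le> N * (1 / p)" using of_nat_div_le_of_nat[of N p] by simp
        finally show ?thesis using True by (simp add: add_increasing)
      next
        case False
        then have "coprime p r" using P(2) pr by (intro primes_coprime) auto
        then have "p dvd a \<and> r dvd a \<longleftrightarrow> p * r dvd a" for a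
          by (meson divides_mult dvd_mult_left dvd_mult_right)
        then have "(\<Sum>a\<in>{1..N}. ?d p a * ?d r a) = real (N div (p * r))"
          using cnt[of "p * r"] p0 pr by (simp flip: of_bool_conj)
        also have "\<dots> \<le> N * (1 / p) * (1 / r)" using of_nat_div_le_of_nat[of N "p * r"] by simp
        finally show ?thesis using False by simp
      qed
    qed
    also have "\<dots> = N * L + N * L\<^sup>2"
      using P(1) by (simp add: sum.distrib L_def power2_eq_square sum_product sum_distrib_left mult_ac)
    finally show ?thesis .
  qed
  have "(\<Sum>a\<in>{1..N}. (?w a - L)\<^sup>2) = (\<Sum>a\<in>{1..N}. (?w a)\<^sup>2) - 2 * L * (\<Sum>a\<in>{1..N}. ?w a) + N * L\<^sup>2"
    by (simp add: power2_diff sum.distrib sum_subtractf sum_distrib_left mult_ac)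
  also have "\<dots> \<le> (N * L + N * L\<^sup>2) - 2 * L * (N * L - N) + N * L\<^sup>2"
    using second mult_left_mono[OF first, of "2 * L"] L0 by simp
  also have "\<dots> = 3 * N * L" by (simp add: algebra_simps power2_eq_square)
  finally show ?thesis .
qed

text \<open>Only primes above \<open>22\<close> are used, because \<open>1 / (p - 2) \<le> 1.1 / p\<close> holds for them; this keeps the
  mean of \<open>2 ^ prime_weight P m\<close> below \<open>exp (1.1 * L)\<close>.\<close>

lemma dense_set_with_few_products:
  "\<forall>\<^sub>F N in sequentially. \<exists>A\<subseteq>{1..N}. N \<le> 2 * card A \<and>
     real (card {a * b |a b. a \<in> A \<and> b \<in> A}) \<le> exp (22/10) * (real N)\<^sup>2 / ln (real N) powr (1/20)"
proof -
  have "filterlim (\<lambda>N. ln (ln (real N))) at_top sequentially"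
    by (intro filterlim_compose[OF ln_at_top] filterlim_real_sequentially)
  then have ev: "\<forall>\<^sub>F N in sequentially. ln (ln (real N)) \<ge> 1244"
    by (auto simp: filterlim_at_top)
  have main: "\<exists>A\<subseteq>{1..N}. N \<le> 2 * card A \<and>
       real (card {a * b |a b. a \<in> A \<and> b \<in> A}) \<le> exp (22/10) * (real N)\<^sup>2 / ln (real N) powr (1/20)"
    if big: "ln (ln (real N)) \<ge> 1244" and N2: "N \<ge> 2" for N
  proof -
    define P where "P = {p. prime p \<and> 22 < p \<and> p \<le> N}"
    define L where "L = (\<Sum>p\<in>P. 1 / real p)"
    define \<omega> where "\<omega> a = card {p\<in>P. p dvd a}" for a
    define A where "A = {a\<in>{1..N}. real (\<omega> a) \<ge> 9/10 * L}"
    have finP: "finite P" by (simp add: P_def)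
    have P: "prime p" "22 < p" "p \<le> N" if "p \<in> P" for p using that by (auto simp: P_def)
    have L_ge: "L \<ge> ln (ln (real N)) / 2 - 22"
    proof -
      have "ln (ln (real N)) / 2 \<le> (\<Sum>p\<in>{p. prime p \<and> p \<le> N}. 1 / real p)"
        by (rule sum_prime_reciprocals_ge[OF N2])
      also have "\<dots> \<le> (\<Sum>p\<in>P \<union> {1..22}. 1 / real p)"
        using finP by (intro sum_mono2) (auto simp: P_def dest: prime_gt_0_nat)
      also have "\<dots> = L + (\<Sum>p\<in>{1..22::nat}. 1 / real p)"
        unfolding L_def using finP by (intro sum.union_disjoint) (auto simp: P_def)
      also have "(\<Sum>p\<in>{1..22::nat}. 1 / real p) \<le> (\<Sum>p\<in>{1..22::nat}. 1)"
        by (intro sum_mono) auto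
      finally show ?thesis by simp
    qed
    then have L600: "L \<ge> 600" using big by simp
    have "card {a\<in>{1..N}. \<not> real (\<omega> a) \<ge> 9/10 * L} * (L / 10)\<^sup>2
        = (\<Sum>a\<in>{a\<in>{1..N}. \<not> real (\<omega> a) \<ge> 9/10 * L}. (L / 10)\<^sup>2)" by simp
    also have "\<dots> \<le> (\<Sum>a\<in>{a\<in>{1..N}. \<not> real (\<omega> a) \<ge> 9/10 * L}. (real (\<omega> a) - L)\<^sup>2)"
      using L600 by (intro sum_mono) (auto simp: abs_le_square_iff[symmetric])
    also have "\<dots> \<le> (\<Sum>a\<in>{1..N}. (real (\<omega> a) - L)\<^sup>2)"
      by (intro sum_mono2) auto
    also have "\<dots> \<le> 3 * N * L"
      unfolding \<omega>_def L_def using finP P by (intro turan) auto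
    finally have "real (card {a\<in>{1..N}. \<not> real (\<omega> a) \<ge> 9/10 * L}) * L * L \<le> 300 * N * L"
      by (simp add: power2_eq_square algebra_simps)
    then have "real (card {a\<in>{1..N}. \<not> real (\<omega> a) \<ge> 9/10 * L}) * L \<le> 300 * N"
      using L600 by simp
    moreover have "real (card {a\<in>{1..N}. \<not> real (\<omega> a) \<ge> 9/10 * L}) * 600
       \<le> real (card {a\<in>{1..N}. \<not> real (\<omega> a) \<ge> 9/10 * L}) * L"
      using L600 by (intro mult_left_mono) auto
    moreover have "card A + card {a\<in>{1..N}. \<not> real (\<omega> a) \<ge> 9/10 * L} = N"
    proof -
      have "card (A \<union> {a\<in>{1..N}. \<not> real (\<omega> a) \<ge> 9/10 * L}) =
        card A + card {a\<in>{1..N}. \<not> real (\<omega> a) \<ge> 9/10 * L}"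
        by (intro card_Un_disjoint) (auto simp: A_def)
      moreover have "A \<union> {a\<in>{1..N}. \<not> real (\<omega> a) \<ge> 9/10 * L} = {1..N}" by (auto simp: A_def)
      ultimately show ?thesis by simp
    qed
    ultimately have dense: "N \<le> 2 * card A" by linarith
    let ?T = "{a * b |a b. a \<in> A \<and> b \<in> A}"
    have T: "m \<in> {1..N\<^sup>2} \<and> 2 powr (18/10 * L) \<le> 2 ^ prime_weight P m" if "m \<in> ?T" for m
    proof -
      obtain a b where m: "m = a * b" and ab: "a \<in> A" "b \<in> A" using \<open>m \<in> ?T\<close> by auto
      then have pos: "a > 0" "b > 0" and le: "a \<le> N" "b \<le> N" by (auto simp: A_def)
      have "18/10 * L \<le> real (\<omega> a) + real (\<omega> b)" using ab by (auto simp: A_def)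
      also have "\<dots> \<le> real (prime_weight P a) + real (prime_weight P b)"
        unfolding \<omega>_def using pos finP P
        by (intro add_mono of_nat_mono card_prime_divisors_le_prime_weight) auto
      also have "\<dots> = prime_weight P m" using prime_weight_mult[of P a b] pos P m by simp
      finally have "2 powr (18/10 * L) \<le> 2 powr (real (prime_weight P m))" by simp
      then show ?thesis
        using pos le m by (auto simp: powr_realpow power2_eq_square mult_le_mono Suc_le_eq)
    qed
    then have Tsub: "?T \<subseteq> {1..N\<^sup>2}" by blast
    have "real (card ?T) * 2 powr (18/10 * L) = (\<Sum>m\<in>?T. 2 powr (18/10 * L))" by simp
    also have "\<dots> \<le> (\<Sum>m\<in>?T. 2 ^ prime_weight P m)" using T by (intro sum_mono) auto
    also have "\<dots> \<le> (\<Sum>m\<in>{1..N\<^sup>2}. 2 ^ prime_weight P m)" using Tsub by (intro sum_mono2) auto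
    also have "\<dots> \<le> real (N\<^sup>2) * (\<Prod>p\<in>P. 1 + 1 / (real p - 2))"
      using finP P by (intro sum_two_power_prime_weight_le) force+
    also have "\<dots> \<le> real (N\<^sup>2) * (\<Prod>p\<in>P. exp (11/10 * (1 / real p)))"
    proof (intro mult_left_mono prod_mono conjI)
      fix p assume "p \<in> P"
      then have p: "real p \<ge> 23" using P(2)[of p] by simp
      then show "0 \<le> 1 + 1 / (real p - 2)" by simp
      have "1 + 1 / (real p - 2) \<le> 1 + 11/10 * (1 / real p)" using p by (simp add: field_simps)
      also have "\<dots> \<le> exp (11/10 * (1 / real p))" by (rule exp_ge_add_one_self)
      finally show "1 + 1 / (real p - 2) \<le> exp (11/10 * (1 / real p))" .
    qed auto
    also have "(\<Prod>p\<in>P. exp (11/10 * (1 / real p))) = exp (11/10 * L)"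
      unfolding L_def sum_distrib_left by (rule exp_sum[OF finP, symmetric])
    finally have "real (card ?T) * exp (18/10 * L * ln 2) \<le> (real N)\<^sup>2 * exp (11/10 * L)"
      by (simp add: powr_def)
    then have "real (card ?T) \<le> (real N)\<^sup>2 * exp (11/10 * L - 18/10 * L * ln 2)"
      by (simp add: exp_diff pos_le_divide_eq)
    also have "\<dots> \<le> (real N)\<^sup>2 * exp (22/10 - 1/20 * ln (ln (real N)))"
    proof -
      have "18/10 * L * (2/3) \<le> 18/10 * L * ln 2"
        using ln2_ge_two_thirds L600 by (intro mult_left_mono) auto
      then show ?thesis using L_ge by (intro mult_left_mono) auto
    qed
    also have "\<dots> = exp (22/10) * (real N)\<^sup>2 / ln (real N) powr (1/20)"
      using N2 by (simp add: exp_diff powr_def)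
    finally show ?thesis using dense by (intro exI[of _ A]) (auto simp: A_def)
  qed
  show ?thesis
    using ev eventually_ge_at_top[of "2::nat"] by eventually_elim (rule main)
qed

section \<open>Bounds for the sum-product of a matching\<close>

lemma matching_sum_product_le_div_sqrt:
  fixes G :: "'a graph" and A :: "int set"
  assumes G: "matching n G" and A: "finite A" "card A = n" and n: "n \<ge> 3"
  shows "sum_product TYPE(int) G \<le> 65536 / sqrt n *
    max (card (sum id ` {e. e \<subseteq> A \<and> card e = 2})) (card (prod id ` {e. e \<subseteq> A \<and> card e = 2}))"
    (is "_ \<le> _ * real (max (card ?S) (card ?T))")
proof -
  define A' where "A' = A - {0}"
  let ?S' = "sum id ` {e. e \<subseteq> A' \<and> card e = 2}" and ?T' = "prod id ` {e. e \<subseteq> A' \<and> card e = 2}"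
  have A': "finite A'" "0 \<notin> A'" using A by (auto simp: A'_def)
  have cA: "n \<le> card A' + 1"
    using A n by (simp add: A'_def card_Diff_singleton_if)
  define p where "p = 1 / sqrt (8 * card A')"
  have p: "0 < p" "p \<le> 1" using cA n by (auto simp: p_def)
  have "sum_product TYPE(int) G \<le> 65536 * max (p * card ?S') (p * card ?T')"
    using cA n p by (intro matching_sum_product_le_of_set[OF G A']) (auto simp: p_def)
  also have "\<dots> \<le> 65536 * (1 / sqrt n * real (max (card ?S) (card ?T)))"
  proof -
    have "finite {e. e \<subseteq> A \<and> card e = 2}" using A(1) by (auto intro: finite_subset[of _ "Pow A"])
    then have le: "card ?S' \<le> card ?S" "card ?T' \<le> card ?T"
      by (intro card_mono finite_imageI image_mono; auto simp: A'_def)+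
    have "real n \<le> 8 * card A'" using cA n by simp
    then have "p \<le> 1 / sqrt n" unfolding p_def using n by (intro divide_left_mono) auto
    then have "p * card ?S' \<le> 1 / sqrt n * real (max (card ?S) (card ?T))"
      "p * card ?T' \<le> 1 / sqrt n * real (max (card ?S) (card ?T))"
      using le by (intro mult_mono; simp add: le_max_iff_disj)+
    then show ?thesis by (intro mult_left_mono) auto
  qed
  finally show ?thesis by simp
qed

lemma matching_sum_product_le_complete_graph:
  fixes G :: "'a graph"
  assumes G: "matching n G" and n: "n \<ge> 3"
  shows "sum_product TYPE(int) G \<le> 65536 / sqrt n * sum_product TYPE(int) (complete_graph n)"
proof -
  let ?K = "complete_graph n"
  have "finite_simple_graph ?K" by (auto simp: finite_simple_graph_def complete_graph_def)
  then obtain a :: "nat \<Rightarrow> int" where a: "inj_on a (verts ?K)"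
    "sum_product TYPE(int) ?K = max (card (graph_sums ?K a)) (card (graph_products ?K a))"
    by (rule sum_product_attained)
  define A where "A = a ` {..<n}"
  have inj: "inj_on a {..<n}" using a(1) by (simp add: complete_graph_def)
  have A: "finite A" "card A = n" using inj by (simp_all add: A_def card_image)
  have "graph_sums ?K a \<subseteq> (\<lambda>(u, v). a u + a v) ` ({..<n} \<times> {..<n})"
    "graph_products ?K a \<subseteq> (\<lambda>(u, v). a u * a v) ` ({..<n} \<times> {..<n})"
    by (force simp: graph_sums_def graph_products_def complete_graph_def)+
  then have fin: "finite (graph_sums ?K a)" "finite (graph_products ?K a)"
    by (auto intro: finite_subset)
  have "sum id e \<in> graph_sums ?K a \<and> prod id e \<in> graph_products ?K a" if e: "e \<subseteq> A" "card e = 2" for e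
  proof -
    obtain x y where xy: "e = {x, y}" "x \<noteq> y" using e(2) by (auto simp: card_2_iff)
    then obtain u v where uv: "u < n" "v < n" "x = a u" "y = a v" using e(1) by (auto simp: A_def)
    then have "{u, v} \<in> edges ?K" using xy by (auto simp: complete_graph_def card_2_iff)
    then show ?thesis using xy uv by (auto simp: graph_sums_def graph_products_def)
  qed
  then have "max (card (sum id ` {e. e \<subseteq> A \<and> card e = 2})) (card (prod id ` {e. e \<subseteq> A \<and> card e = 2}))
    \<le> sum_product TYPE(int) ?K"
    unfolding a(2) using fin by (intro max.mono card_mono) auto
  then have "65536 / sqrt n * max (card (sum id ` {e. e \<subseteq> A \<and> card e = 2})) (card (prod id ` {e. e \<subseteq> A \<and> card e = 2}))
    \<le> 65536 / sqrt n * sum_product TYPE(int) ?K"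
    by (intro mult_left_mono of_nat_mono) auto
  then show ?thesis using matching_sum_product_le_div_sqrt[OF G A n] by linarith
qed

lemma matching_sum_product_le_sumset:
  fixes G :: "'a graph" and A :: "int set"
  assumes G: "matching n G" and A: "finite A" "card A = n" and n: "n \<ge> 3"
  shows "sum_product TYPE(int) G \<le> 65536 / sqrt n * max (card (A + A)) (card (A * A))"
proof -
  have "sum id e \<in> A + A \<and> prod id e \<in> A * A" if "e \<subseteq> A" "card e = 2" for e
    using that by (auto simp: card_2_iff)
  then have "max (card (sum id ` {e. e \<subseteq> A \<and> card e = 2})) (card (prod id ` {e. e \<subseteq> A \<and> card e = 2}))
    \<le> max (card (A + A)) (card (A * A))"
    using A(1) by (intro max.mono card_mono finite_set_plus finite_set_times) auto
  then have "65536 / sqrt n * max (card (sum id ` {e. e \<subseteq> A \<and> card e = 2})) (card (prod id ` {e. e \<subseteq> A \<and> card e = 2}))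
    \<le> 65536 / sqrt n * max (card (A + A)) (card (A * A))"
    by (intro mult_left_mono of_nat_mono) auto
  then show ?thesis using matching_sum_product_le_div_sqrt[OF G A n] by linarith
qed

text \<open>The integers in \<open>A\<close> have at most \<open>3 * n\<close> sums and, up to a constant, at most \<open>n\<^sup>2 / w\<^sup>2\<close> products,
  where \<open>w = (ln n) powr (1/40)\<close>. Sampling sums with density \<open>1 / w\<close> and products with density of
  order \<open>w / n\<close> leaves \<open>O(n / w)\<close> of each.\<close>

lemma matching_sum_product_log_saving:
  fixes G :: "'a graph" and A :: "nat set"
  assumes G: "matching n G" and A: "A \<subseteq> {1..n}" "n \<le> 2 * card A"
    and prods: "real (card {a * b |a b. a \<in> A \<and> b \<in> A}) \<le> exp (22/10) * (real n)\<^sup>2 / ln (real n) powr (1/20)"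
    and n: "ln (real n) \<ge> 1" "n \<ge> 4"
  shows "sum_product TYPE(int) G \<le> 65536 * (3 + exp (22/10)) * n / ln (real n) powr (1/40)"
proof -
  define I where "I = int ` A"
  define w where "w = ln (real n) powr (1/40)"
  let ?N = "real (card I)"
  let ?E = "{e. e \<subseteq> I \<and> card e = 2}"
  have w1: "w \<ge> 1" unfolding w_def using n(1) by (simp add: ge_one_powr_ge_zero)
  have "w \<le> ln (real n) powr 1" unfolding w_def using n(1) by (intro powr_mono) auto
  also have "\<dots> \<le> n" using n ln_bound[of "real n"] by simp
  finally have wn: "w \<le> n" .
  have w2: "ln (real n) powr (1/20) = w * w"
    unfolding w_def by (simp flip: powr_add)
  have finA: "finite A" using A(1) finite_subset by blast
  have cardI: "card I = card A" by (simp add: I_def card_image)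
  have N: "n \<le> 2 * ?N" "?N > 0" using A(2) n(2) cardI by linarith+
  define p q where "p = 1 / w" and "q = w / (8 * ?N)"
  have p: "0 < p" "p \<le> 1" using w1 by (auto simp: p_def)
  have q: "0 < q" "q \<le> 1" using w1 wn N by (auto simp: q_def)
  have "sum id ` ?E \<subseteq> {0..2 * int n}"
  proof
    fix x assume "x \<in> sum id ` ?E"
    then obtain e where e: "e \<subseteq> I" "card e = 2" "x = sum id e" by auto
    then obtain u v where "e = {u, v}" "u \<noteq> v" by (auto simp: card_2_iff)
    with e obtain a b where x: "x = int a + int b" and "a \<in> A" "b \<in> A" by (auto simp: I_def)
    then have "a \<le> n" "b \<le> n" using A(1) by auto
    then show "x \<in> {0..2 * int n}" by (simp add: x)
  qed
  then have "card (sum id ` ?E) \<le> card {0..2 * int n}" by (intro card_mono) auto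
  then have S: "real (card (sum id ` ?E)) \<le> 3 * n" using n(2) by simp
  have "prod id ` ?E \<subseteq> int ` {a * b |a b. a \<in> A \<and> b \<in> A}"
  proof
    fix x assume "x \<in> prod id ` ?E"
    then obtain e where e: "e \<subseteq> I" "card e = 2" "x = prod id e" by auto
    then obtain u v where "e = {u, v}" "u \<noteq> v" by (auto simp: card_2_iff)
    with e obtain a b where "x = int a * int b" "a \<in> A" "b \<in> A" by (auto simp: I_def)
    then show "x \<in> int ` {a * b |a b. a \<in> A \<and> b \<in> A}" by (intro image_eqI[of _ _ "a * b"]) auto
  qed
  moreover have finAA: "finite {a * b |a b. a \<in> A \<and> b \<in> A}"
    using finA by (intro finite_image_set2) auto
  ultimately have "card (prod id ` ?E) \<le> card {a * b |a b. a \<in> A \<and> b \<in> A}"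
    by (intro surj_card_le) auto
  then have T: "real (card (prod id ` ?E)) \<le> exp (22/10) * (real n)\<^sup>2 / (w * w)"
    using prods w2 by simp
  have "p * card (sum id ` ?E) \<le> (3 + exp (22/10)) * n / w"
  proof -
    have "p * card (sum id ` ?E) \<le> p * (3 * n)" using S p by (intro mult_left_mono) auto
    also have "\<dots> \<le> (3 + exp (22/10)) * n / w" using w1 by (simp add: p_def field_simps)
    finally show ?thesis .
  qed
  moreover have "q * card (prod id ` ?E) \<le> (3 + exp (22/10)) * n / w"
  proof -
    have "q \<le> w / (4 * n)" unfolding q_def using N w1 n(2) by (intro divide_left_mono) auto
    then have "q * card (prod id ` ?E) \<le> w / (4 * n) * (exp (22/10) * (real n)\<^sup>2 / (w * w))"
      using T q w1 by (intro mult_mono) auto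
    also have "\<dots> = exp (22/10) / 4 * n / w"
      using w1 n(2) by (simp add: field_simps power2_eq_square)
    also have "\<dots> \<le> (3 + exp (22/10)) * n / w"
      using w1 by (intro divide_right_mono mult_right_mono) auto
    finally show ?thesis .
  qed
  moreover have "sum_product TYPE(int) G \<le>
      65536 * max (p * card (sum id ` ?E)) (q * card (prod id ` ?E))"
    using A N n finA p q w1 cardI
    by (intro matching_sum_product_le_of_set[OF G]) (auto simp: I_def p_def q_def)
  ultimately have "sum_product TYPE(int) G \<le> 65536 * ((3 + exp (22/10)) * n / w)" by linarith
  then show ?thesis by (simp only: w_def mult.assoc times_divide_eq_right)
qed

theorem theorem1:
  fixes M :: "nat \<Rightarrow> 'a graph"
  assumes "\<And>n. matching n (M n)"
  shows "(\<lambda>n. real (sum_product TYPE(int) (M n)))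
           \<in> O(\<lambda>n. real (sum_product TYPE(int) (complete_graph n)) / sqrt (real n))
       \<and> (\<exists>\<epsilon>>0. \<forall>\<^sub>F n in sequentially.
            real (sum_product TYPE(int) (M n)) \<le> real n / ln (real n) powr \<epsilon>)
       \<and> (\<forall>\<delta>>0. (\<lambda>n. real (sum_product TYPE(int) (M n))) \<in> \<Omega>(\<lambda>n. real n powr (1/2 + \<delta>)) \<longrightarrow>
            (\<exists>c>0. \<forall>\<^sub>F n in sequentially. \<forall>A :: int set. finite A \<and> card A = n \<longrightarrow>
               real (max (card (A + A)) (card (A * A))) \<ge> c * real n powr (1 + \<delta>)))"
proof (intro conjI allI impI)
  show "(\<lambda>n. real (sum_product TYPE(int) (M n)))
           \<in> O(\<lambda>n. real (sum_product TYPE(int) (complete_graph n)) / sqrt (real n))"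
  proof (rule bigoI)
    show "\<forall>\<^sub>F n in sequentially. norm (real (sum_product TYPE(int) (M n)))
      \<le> 65536 * norm (real (sum_product TYPE(int) (complete_graph n)) / sqrt (real n))"
      using eventually_ge_at_top[of 3]
    proof eventually_elim
      case (elim n)
      then show ?case using matching_sum_product_le_complete_graph[OF assms, of n] by simp
    qed
  qed
next
  define C :: real where "C = 65536 * (3 + exp (22/10))"
  have lim: "filterlim (\<lambda>n. ln (real n)) at_top sequentially"
    by (intro filterlim_compose[OF ln_at_top] filterlim_real_sequentially)
  have "\<forall>\<^sub>F n in sequentially. ln (real n) \<ge> max 1 (C powr 80)"
    using lim unfolding filterlim_at_top by blast
  \<comment> \<open>Half of the saving \<open>(ln n) powr (1/40)\<close> absorbs the constant \<open>C\<close>.\<close>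
  then have "\<forall>\<^sub>F n in sequentially. real (sum_product TYPE(int) (M n)) \<le> real n / ln (real n) powr (1/80)"
    using dense_set_with_few_products eventually_ge_at_top[of 4]
  proof eventually_elim
    case (elim n)
    let ?l = "ln (real n)"
    have C0: "C > 0" by (simp add: C_def add_pos_pos)
    have "C = (C powr 80) powr (1/80)" using C0 by (simp only: powr_powr) simp
    also have "\<dots> \<le> ?l powr (1/80)" using elim(1) by (intro powr_mono2) auto
    finally have Cl: "C \<le> ?l powr (1/80)" .
    have l0: "?l powr (1/80) > 0" using elim(1) by simp
    have split: "?l powr (1/40) = ?l powr (1/80) * ?l powr (1/80)" by (simp flip: powr_add)
    obtain A where A: "A \<subseteq> {1..n}" "n \<le> 2 * card A"
      "real (card {a * b |a b. a \<in> A \<and> b \<in> A}) \<le> exp (22/10) * (real n)\<^sup>2 / ?l powr (1/20)"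
      using elim(2) by blast
    have "real (sum_product TYPE(int) (M n)) \<le> C * n / ?l powr (1/40)"
      unfolding C_def using elim(1,3) by (intro matching_sum_product_log_saving[OF assms A]) auto
    also have "\<dots> \<le> ?l powr (1/80) * n / ?l powr (1/40)"
      using Cl by (intro divide_right_mono mult_right_mono) auto
    also have "\<dots> = n / ?l powr (1/80)" using l0 by (simp add: split)
    finally show ?case .
  qed
  then show "\<exists>\<epsilon>>0. \<forall>\<^sub>F n in sequentially.
            real (sum_product TYPE(int) (M n)) \<le> real n / ln (real n) powr \<epsilon>"
    by (intro exI[of _ "1/80"]) auto
next
  fix \<delta> :: real
  assume "(\<lambda>n. real (sum_product TYPE(int) (M n))) \<in> \<Omega>(\<lambda>n. real n powr (1/2 + \<delta>))"
  then obtain c where c: "c > 0" "\<forall>\<^sub>F n in sequentially.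
      norm (real (sum_product TYPE(int) (M n))) \<ge> c * norm (real n powr (1/2 + \<delta>))"
    by (rule landau_omega.bigE)
  have "\<forall>\<^sub>F n in sequentially. \<forall>A :: int set. finite A \<and> card A = n \<longrightarrow>
     c / 65536 * real n powr (1 + \<delta>) \<le> real (max (card (A + A)) (card (A * A)))"
    using c(2) eventually_ge_at_top[of 3]
  proof eventually_elim
    case (elim n)
    show ?case
    proof (intro allI impI)
      fix A :: "int set" assume A: "finite A \<and> card A = n"
      have "c * real n powr (1/2 + \<delta>) \<le> 65536 / sqrt n * max (card (A + A)) (card (A * A))"
        using elim matching_sum_product_le_sumset[OF assms, of A n] A by simp
      then have "c * real n powr (1/2 + \<delta>) * sqrt n \<le> 65536 * max (card (A + A)) (card (A * A))"
        using elim(2) by (simp add: field_simps)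
      moreover have "real n powr (1/2 + \<delta>) * sqrt n = real n powr (1 + \<delta>)"
        by (simp add: powr_half_sqrt[symmetric] flip: powr_add)
      ultimately show "c / 65536 * real n powr (1 + \<delta>) \<le> real (max (card (A + A)) (card (A * A)))"
        by (simp add: mult.assoc)
    qed
  qed
  then show "\<exists>c>0. \<forall>\<^sub>F n in sequentially. \<forall>A :: int set. finite A \<and> card A = n \<longrightarrow>
     c * real n powr (1 + \<delta>) \<le> real (max (card (A + A)) (card (A * A)))"
    using c(1) by (intro exI[of _ "c / 65536"]) auto
qed

end
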